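(* Let $P$ be a Poisson algebra, $E$ a vector space and $\pi:E\to P$ an epimorphism of vector spaces with $V=\mathrm{Ker}(\pi)$. Then any Poisson algebra structure $(\cdot_E,[-,-]_E)$ which can be defined on $E$ such that $\pi:(E,\cdot_E,[-,-]_E)\to P$ is a morphism of Poisson algebras is isomorphic to a crossed product $P\,\sharp\,V$ and, moreover, the isomorphism of Poisson algebras $(E,\cdot_E,[-,-]_E)\cong P\,\sharp\,V$ can be chosen such that it stabilizes $V$ and co-stabilizes $P$. In particular, any Poisson algebra extension of $P$ by $V$ is cohomologous to a crossed product extension $0\to V\xrightarrow{i_V}P\,\sharp\,V\xrightarrow{\pi_P}P\to0$, where $i_V(x)=(0,x)$ and $\pi_P(p,x)=p$.
   Context: $k$ is an arbitrary field; everything is over $k$. Algebras are associative, not necessarily commutative or unital. A Poisson algebra is a vector space $P$ with an associative multiplication $pq$ and a Lie bracket $[-,-]$ such that $[pq,r]=[p,r]q+p[q,r]$ for all $p,q,r\in P$. A morphism of Poisson algebras is a linear map that is a morphism of associative algebras and of Lie algebras. A pre-crossed datum of $P$ by a vector space $V$ is a system $\Omega(P,V)=(\rightharpoonup,\triangleleft,\vartheta,\cdot_V,\triangleright,f,[-,-]_V)$ of seven bilinear maps $\rightharpoonup:P\times V\to V$, $\triangleleft:V\times P\to V$, $\vartheta:P\times P\to V$, $\cdot_V:V\times V\to V$, $\triangleright:P\times V\to V$, $f:P\times P\to V$, $[-,-]_V:V\times V\to V$. Let $P\,\sharp\,V$ be the vector space $P\times V$ with $(p,x)\star(q,y):=(pq,\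 \vartheta(p,q)+p\rightharpoonup y+x\triangleleft q+x\cdot_V y)$ and $\{(p,x),(q,y)\}:=([p,q],\ f(p,q)+p\triangleright y-q\triangleright x+[x,y]_V)$. If this is a Poisson algebra, $\Omega(P,V)$ is called a crossed system of $P$ by $V$ and $P\,\sharp\,V$ a crossed product. An isomorphism $\varphi:P\,\sharp\,V\to E$ stabilizes $V$ if $\varphi(0,x)=x$ for all $x\in V$, and co-stabilizes $P$ if $\pi(\varphi(p,x))=p$ for all $(p,x)\in P\times V$. An extension of $P$ by $V$ is an exact sequence of Poisson algebras $0\to V\xrightarrow{i}\mathfrak{E}\xrightarrow{p}P\to0$; two extensions are cohomologous if there is an isomorphism of Poisson algebras $\varphi:\mathfrak{E}\to\mathfrak{E}'$ with $\varphi\circ i=i'$ and $p'\circ\varphi=p$. *)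

theory Defs
  imports Complex_Main "HOL-Library.Product_Plus"
begin

text \<open>
  A vector space over the field \<open>'k\<close> is carried by a subset of a type: a linear subspace of an
  ambient type of class \<open>ab_group_add\<close> equipped with a scalar multiplication that satisfies the
  library locale \<open>vector_space\<close>. This allows kernels, whole types and products to be treated on
  the same footing. All maps are considered on carriers only; their values elsewhere are irrelevant.
\<close>

record ('k, 'a) vspace =
  vcarrier :: "'a set"
  vscale :: "'k \<Rightarrow> 'a \<Rightarrow> 'a"

record ('k, 'a) poisson = "('k, 'a) vspace" +
  pmult :: "'a \<Rightarrow> 'a \<Rightarrow> 'a"
  pbracket :: "'a \<Rightarrow> 'a \<Rightarrow> 'a"

definition is_vspace :: "('k::field, 'a::ab_group_add, 'm) vspace_scheme \<Rightarrow> bool" where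
  "is_vspace A \<longleftrightarrow> vector_space (vscale A) \<and> module.subspace (vscale A) (vcarrier A)"

definition linear_map ::
  "('k::field, 'a::ab_group_add, 'm) vspace_scheme \<Rightarrow> ('k, 'b::ab_group_add, 'n) vspace_scheme
    \<Rightarrow> ('a \<Rightarrow> 'b) \<Rightarrow> bool" where
  "linear_map A B h \<longleftrightarrow>
     (\<forall>x\<in>vcarrier A. h x \<in> vcarrier B) \<and>
     (\<forall>x\<in>vcarrier A. \<forall>y\<in>vcarrier A. h (x + y) = h x + h y) \<and>
     (\<forall>c. \<forall>x\<in>vcarrier A. h (vscale A c x) = vscale B c (h x))"

definition bilinear_map ::
  "('k::field, 'a::ab_group_add, 'm) vspace_scheme \<Rightarrow> ('k, 'b::ab_group_add, 'n) vspace_scheme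
    \<Rightarrow> ('k, 'c::ab_group_add, 'l) vspace_scheme \<Rightarrow> ('a \<Rightarrow> 'b \<Rightarrow> 'c) \<Rightarrow> bool" where
  "bilinear_map A B C h \<longleftrightarrow>
     (\<forall>x\<in>vcarrier A. linear_map B C (h x)) \<and>
     (\<forall>y\<in>vcarrier B. linear_map A C (\<lambda>x. h x y))"

definition kernel_space ::
  "('k::field, 'a::ab_group_add, 'm) vspace_scheme \<Rightarrow> ('a \<Rightarrow> 'b::ab_group_add)
    \<Rightarrow> ('k, 'a) vspace" where
  "kernel_space A h = \<lparr>vcarrier = {x \<in> vcarrier A. h x = 0}, vscale = vscale A\<rparr>"


definition assoc_mult ::
  "('k::field, 'a::ab_group_add, 'm) vspace_scheme \<Rightarrow> ('a \<Rightarrow> 'a \<Rightarrow> 'a) \<Rightarrow> bool" where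
  "assoc_mult A m \<longleftrightarrow> bilinear_map A A A m \<and>
     (\<forall>x\<in>vcarrier A. \<forall>y\<in>vcarrier A. \<forall>z\<in>vcarrier A. m (m x y) z = m x (m y z))"

text \<open>In characteristic 2 antisymmetry would be weaker than \<open>b x x = 0\<close>.\<close>

definition lie_bracket ::
  "('k::field, 'a::ab_group_add, 'm) vspace_scheme \<Rightarrow> ('a \<Rightarrow> 'a \<Rightarrow> 'a) \<Rightarrow> bool" where
  "lie_bracket A b \<longleftrightarrow> bilinear_map A A A b \<and>
     (\<forall>x\<in>vcarrier A. b x x = 0) \<and>
     (\<forall>x\<in>vcarrier A. \<forall>y\<in>vcarrier A. \<forall>z\<in>vcarrier A.
        b x (b y z) + b y (b z x) + b z (b x y) = 0)"

definition poisson_algebra :: "('k::field, 'a::ab_group_add, 'm) poisson_scheme \<Rightarrow> bool" where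
  "poisson_algebra A \<longleftrightarrow>
     is_vspace A \<and> assoc_mult A (pmult A) \<and> lie_bracket A (pbracket A) \<and>
     (\<forall>p\<in>vcarrier A. \<forall>q\<in>vcarrier A. \<forall>r\<in>vcarrier A.
        pbracket A (pmult A p q) r = pmult A (pbracket A p r) q + pmult A p (pbracket A q r))"

definition equip ::
  "('k, 'a, 'm) vspace_scheme \<Rightarrow> ('a \<Rightarrow> 'a \<Rightarrow> 'a) \<Rightarrow> ('a \<Rightarrow> 'a \<Rightarrow> 'a) \<Rightarrow> ('k, 'a) poisson" where
  "equip A m b = \<lparr>vcarrier = vcarrier A, vscale = vscale A, pmult = m, pbracket = b\<rparr>"

definition poisson_hom ::
  "('k::field, 'a::ab_group_add, 'm) poisson_scheme \<Rightarrow> ('k, 'b::ab_group_add, 'n) poisson_scheme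
    \<Rightarrow> ('a \<Rightarrow> 'b) \<Rightarrow> bool" where
  "poisson_hom A B h \<longleftrightarrow> linear_map A B h \<and>
     (\<forall>x\<in>vcarrier A. \<forall>y\<in>vcarrier A.
        h (pmult A x y) = pmult B (h x) (h y) \<and>
        h (pbracket A x y) = pbracket B (h x) (h y))"

definition poisson_iso ::
  "('k::field, 'a::ab_group_add, 'm) poisson_scheme \<Rightarrow> ('k, 'b::ab_group_add, 'n) poisson_scheme
    \<Rightarrow> ('a \<Rightarrow> 'b) \<Rightarrow> bool" where
  "poisson_iso A B h \<longleftrightarrow> poisson_hom A B h \<and> bij_betw h (vcarrier A) (vcarrier B)"


text \<open>
  The seven maps of a pre-crossed datum, in the order
  \<open>(\<rightharpoonup>, \<triangleleft>, \<vartheta>, \<cdot>\<^sub>V, \<triangleright>, f, [-,-]\<^sub>V)\<close>.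
\<close>

record ('p, 'v) datum =
  d_lact :: "'p \<Rightarrow> 'v \<Rightarrow> 'v"
  d_ract :: "'v \<Rightarrow> 'p \<Rightarrow> 'v"
  d_theta :: "'p \<Rightarrow> 'p \<Rightarrow> 'v"
  d_mult :: "'v \<Rightarrow> 'v \<Rightarrow> 'v"
  d_lieact :: "'p \<Rightarrow> 'v \<Rightarrow> 'v"
  d_f :: "'p \<Rightarrow> 'p \<Rightarrow> 'v"
  d_bracket :: "'v \<Rightarrow> 'v \<Rightarrow> 'v"

definition pre_crossed_datum ::
  "('k::field, 'p::ab_group_add, 'm) poisson_scheme \<Rightarrow> ('k, 'v::ab_group_add, 'n) vspace_scheme
    \<Rightarrow> ('p, 'v) datum \<Rightarrow> bool" where
  "pre_crossed_datum P V \<Omega> \<longleftrightarrow>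
     bilinear_map P V V (d_lact \<Omega>) \<and>
     bilinear_map V P V (d_ract \<Omega>) \<and>
     bilinear_map P P V (d_theta \<Omega>) \<and>
     bilinear_map V V V (d_mult \<Omega>) \<and>
     bilinear_map P V V (d_lieact \<Omega>) \<and>
     bilinear_map P P V (d_f \<Omega>) \<and>
     bilinear_map V V V (d_bracket \<Omega>)"

text \<open>\<open>P \<sharp> V\<close> on the vector space \<open>P \<times> V\<close>, with componentwise scalar multiplication.\<close>

definition crossed_product ::
  "('k::field, 'p::ab_group_add, 'm) poisson_scheme \<Rightarrow> ('k, 'v::ab_group_add, 'n) vspace_scheme
    \<Rightarrow> ('p, 'v) datum \<Rightarrow> ('k, 'p \<times> 'v) poisson" where
  "crossed_product P V \<Omega> =
     \<lparr>vcarrier = vcarrier P \<times> vcarrier V,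
      vscale = (\<lambda>c. map_prod (vscale P c) (vscale V c)),
      pmult = (\<lambda>(p, x) (q, y).
        (pmult P p q, d_theta \<Omega> p q + d_lact \<Omega> p y + d_ract \<Omega> x q + d_mult \<Omega> x y)),
      pbracket = (\<lambda>(p, x) (q, y).
        (pbracket P p q, d_f \<Omega> p q + d_lieact \<Omega> p y - d_lieact \<Omega> q x + d_bracket \<Omega> x y))\<rparr>"

definition crossed_system ::
  "('k::field, 'p::ab_group_add, 'm) poisson_scheme \<Rightarrow> ('k, 'v::ab_group_add, 'n) vspace_scheme
    \<Rightarrow> ('p, 'v) datum \<Rightarrow> bool" where
  "crossed_system P V \<Omega> \<longleftrightarrow>
     pre_crossed_datum P V \<Omega> \<and> poisson_algebra (crossed_product P V \<Omega>)"

text \<open>Here \<open>\<phi>\<close> is a map from the carrier of \<open>P \<sharp> V\<close> to a space containing \<open>V\<close>.\<close>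

definition stabilizes ::
  "('k, 'e::ab_group_add, 'n) vspace_scheme \<Rightarrow> ('p::ab_group_add \<times> 'e \<Rightarrow> 'e) \<Rightarrow> bool" where
  "stabilizes V \<phi> \<longleftrightarrow> (\<forall>x\<in>vcarrier V. \<phi> (0, x) = x)"

definition costabilizes ::
  "('k, 'p, 'm) vspace_scheme \<Rightarrow> ('k, 'e, 'n) vspace_scheme \<Rightarrow> ('e \<Rightarrow> 'p)
    \<Rightarrow> ('p \<times> 'e \<Rightarrow> 'e) \<Rightarrow> bool" where
  "costabilizes P V \<pi> \<phi> \<longleftrightarrow> (\<forall>p\<in>vcarrier P. \<forall>x\<in>vcarrier V. \<pi> (\<phi> (p, x)) = p)"


definition poisson_extension ::
  "('k::field, 'v::ab_group_add, 'n) poisson_scheme \<Rightarrow> ('v \<Rightarrow> 'e)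
    \<Rightarrow> ('k, 'e::ab_group_add, 'l) poisson_scheme \<Rightarrow> ('e \<Rightarrow> 'p)
    \<Rightarrow> ('k, 'p::ab_group_add, 'm) poisson_scheme \<Rightarrow> bool" where
  "poisson_extension V i E p P \<longleftrightarrow>
     poisson_algebra V \<and> poisson_algebra E \<and> poisson_algebra P \<and>
     poisson_hom V E i \<and> poisson_hom E P p \<and>
     inj_on i (vcarrier V) \<and>
     i ` vcarrier V = {e \<in> vcarrier E. p e = 0} \<and>
     p ` vcarrier E = vcarrier P"

text \<open>
  The relation between two sequences \<open>(i, E, p)\<close> and \<open>(i', E', p')\<close> with the same ends; only the
  carrier of the left end \<open>V\<close> is needed.
\<close>

definition cohomologous ::
  "('k::field, 'v::ab_group_add, 'n) vspace_scheme
    \<Rightarrow> ('v \<Rightarrow> 'e) \<Rightarrow> ('k, 'e::ab_group_add, 'l) poisson_scheme \<Rightarrow> ('e \<Rightarrow> 'p)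
    \<Rightarrow> ('v \<Rightarrow> 'd) \<Rightarrow> ('k, 'd::ab_group_add, 'j) poisson_scheme \<Rightarrow> ('d \<Rightarrow> 'p) \<Rightarrow> bool" where
  "cohomologous V i E p i' E' p' \<longleftrightarrow>
     (\<exists>\<phi>. poisson_iso E E' \<phi> \<and>
          (\<forall>x\<in>vcarrier V. \<phi> (i x) = i' x) \<and>
          (\<forall>e\<in>vcarrier E. p' (\<phi> e) = p e))"

end

theory Submission
  imports Defs
begin

text \<open>
  A surjective linear map \<open>\<pi> : E \<rightarrow> P\<close> has a linear section \<open>s\<close>, because a basis of \<open>P\<close> can be lifted
  to \<open>E\<close> elementwise (\<open>linear_section_exists\<close>).
  Once \<open>s\<close> is chosen, \<open>(p, x) \<mapsto> s p + x\<close> is a linear bijection from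
  \<open>P \<times> Ker \<pi>\<close> onto \<open>E\<close>. Multiplying \<open>s p + x\<close> by \<open>s q + y\<close> in \<open>E\<close> gives
  \<open>s p s q + s p y + x s q + x y\<close>. As \<open>\<pi>\<close> is multiplicative, the last three terms and the defect
  \<open>s p s q - s (p q)\<close> all lie in \<open>Ker \<pi>\<close>. These four kernel-valued maps are \<open>\<rightharpoonup>\<close>, \<open>\<triangleleft>\<close>, \<open>\<cdot>\<^sub>V\<close> and
  \<open>\<vartheta>\<close>, and the bracket gives the other three maps in the same way. With this datum the bijection
  turns the operations of \<open>P \<sharp> V\<close> into those of \<open>E\<close> (\<open>poisson_hom_glue\<close>), so the Poisson axioms hold
  in \<open>P \<sharp> V\<close> because they hold in \<open>E\<close> (\<open>poisson_algebra_reflect\<close>);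
  none of the compatibility conditions of a crossed system has to be written out.

  Both halves of the proposition are instances of this argument when the kernel is presented as the
  image of an injective linear map \<open>i : V \<rightarrow> E\<close>, as in \<open>linearly_split_extension\<close>.
  For a structure on a given space \<open>E\<close>, \<open>i\<close> is the inclusion of the kernel; for an extension,
  it is the given map, and the cohomology between the two
  extensions is the inverse of the bijection.
\<close>

section \<open>Linear maps between carriers\<close>

lemma
  assumes "is_vspace A"
  shows is_vspace_vector_space: "vector_space (vscale A)"
    and is_vspace_zero: "0 \<in> vcarrier A"
    and is_vspace_add: "x \<in> vcarrier A \<Longrightarrow> y \<in> vcarrier A \<Longrightarrow> x + y \<in> vcarrier A"
    and is_vspace_scale: "x \<in> vcarrier A \<Longrightarrow> vscale A c x \<in> vcarrier A"
    and is_vspace_neg: "x \<in> vcarrier A \<Longrightarrow> - x \<in> vcarrier A"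
    and is_vspace_diff: "x \<in> vcarrier A \<Longrightarrow> y \<in> vcarrier A \<Longrightarrow> x - y \<in> vcarrier A"
proof -
  interpret vector_space "vscale A" using assms by (simp add: is_vspace_def)
  have S: "subspace (vcarrier A)" using assms by (simp add: is_vspace_def)
  show "vector_space (vscale A)" ..
  show "0 \<in> vcarrier A" by (rule subspace_0[OF S])
  show "x \<in> vcarrier A \<Longrightarrow> y \<in> vcarrier A \<Longrightarrow> x + y \<in> vcarrier A" by (rule subspace_add[OF S])
  show "x \<in> vcarrier A \<Longrightarrow> vscale A c x \<in> vcarrier A" by (rule subspace_scale[OF S])
  show "x \<in> vcarrier A \<Longrightarrow> - x \<in> vcarrier A" by (rule subspace_neg[OF S])
  show "x \<in> vcarrier A \<Longrightarrow> y \<in> vcarrier A \<Longrightarrow> x - y \<in> vcarrier A" by (rule subspace_diff[OF S])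
qed

lemmas is_vspace_closed =
  is_vspace_zero is_vspace_add is_vspace_scale is_vspace_neg is_vspace_diff

lemma vscale_distrib:
  assumes "is_vspace A"
  shows "vscale A c (x + y) = vscale A c x + vscale A c y"
    and "vscale A c (x - y) = vscale A c x - vscale A c y"
    and "vscale A c 0 = 0"
proof -
  interpret vector_space "vscale A" using assms by (rule is_vspace_vector_space)
  show "vscale A c (x + y) = vscale A c x + vscale A c y" by (rule scale_right_distrib)
  show "vscale A c (x - y) = vscale A c x - vscale A c y" by (rule scale_right_diff_distrib)
  show "vscale A c 0 = 0" by (rule scale_zero_right)
qed

lemma linear_mapI:
  assumes "\<And>x. x \<in> vcarrier A \<Longrightarrow> h x \<in> vcarrier B"
    and "\<And>x y. x \<in> vcarrier A \<Longrightarrow> y \<in> vcarrier A \<Longrightarrow> h (x + y) = h x + h y"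
    and "\<And>c x. x \<in> vcarrier A \<Longrightarrow> h (vscale A c x) = vscale B c (h x)"
  shows "linear_map A B h"
  using assms by (simp add: linear_map_def)

lemma
  assumes "linear_map A B h"
  shows linear_map_in: "x \<in> vcarrier A \<Longrightarrow> h x \<in> vcarrier B"
    and linear_map_add: "x \<in> vcarrier A \<Longrightarrow> y \<in> vcarrier A \<Longrightarrow> h (x + y) = h x + h y"
    and linear_map_scale: "x \<in> vcarrier A \<Longrightarrow> h (vscale A c x) = vscale B c (h x)"
  using assms by (simp_all add: linear_map_def)

lemma linear_map_zero:
  assumes "is_vspace A" "linear_map A B h"
  shows "h 0 = 0"
  using linear_map_add[OF assms(2), of 0 0] is_vspace_zero[OF assms(1)] by simp

lemma linear_map_neg:
  assumes "is_vspace A" "linear_map A B h" "x \<in> vcarrier A"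
  shows "h (- x) = - h x"
proof -
  have "h (x + - x) = h x + h (- x)"
    by (intro linear_map_add[OF assms(2)] is_vspace_neg assms)
  then show ?thesis
    by (simp add: linear_map_zero[OF assms(1,2)] eq_neg_iff_add_eq_0 add.commute)
qed

lemma linear_map_diff:
  assumes "is_vspace A" "linear_map A B h" "x \<in> vcarrier A" "y \<in> vcarrier A"
  shows "h (x - y) = h x - h y"
  using linear_map_add[OF assms(2,3) is_vspace_neg[OF assms(1,4)]]
  by (simp add: linear_map_neg[OF assms(1,2,4)])

lemma bilinear_mapI:
  assumes "\<And>x. x \<in> vcarrier A \<Longrightarrow> linear_map B C (h x)"
    and "\<And>y. y \<in> vcarrier B \<Longrightarrow> linear_map A C (\<lambda>x. h x y)"
  shows "bilinear_map A B C h"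
  using assms by (simp add: bilinear_map_def)

lemma
  assumes "bilinear_map A B C h"
  shows bilinear_map_right: "x \<in> vcarrier A \<Longrightarrow> linear_map B C (h x)"
    and bilinear_map_left: "y \<in> vcarrier B \<Longrightarrow> linear_map A C (\<lambda>x. h x y)"
  using assms by (simp_all add: bilinear_map_def)

lemma
  assumes "bilinear_map A B C h" "x \<in> vcarrier A" "y \<in> vcarrier B"
  shows bilinear_map_in: "h x y \<in> vcarrier C"
    and bilinear_map_add_right: "y' \<in> vcarrier B \<Longrightarrow> h x (y + y') = h x y + h x y'"
    and bilinear_map_add_left: "x' \<in> vcarrier A \<Longrightarrow> h (x + x') y = h x y + h x' y"
  using linear_map_in[OF bilinear_map_right] linear_map_add[OF bilinear_map_right]
    linear_map_add[OF bilinear_map_left] assms by blast+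

lemma bilinear_map_zero_right:
  assumes "bilinear_map A B C h" "is_vspace B" "x \<in> vcarrier A"
  shows "h x 0 = 0"
  using linear_map_zero[OF assms(2) bilinear_map_right[OF assms(1,3)]] .

lemma bilinear_map_zero_left:
  assumes "bilinear_map A B C h" "is_vspace A" "y \<in> vcarrier B"
  shows "h 0 y = 0"
  using linear_map_zero[OF assms(2) bilinear_map_left[OF assms(1,3)]] .

lemma linear_map_comp:
  assumes "linear_map A B f" "linear_map B C g"
  shows "linear_map A C (\<lambda>x. g (f x))"
  using assms by (auto simp: linear_map_def)

lemma bilinear_map_comp_args:
  assumes m: "bilinear_map A' B' C m" and f: "linear_map A A' f" and g: "linear_map B B' g"
  shows "bilinear_map A B C (\<lambda>x y. m (f x) (g y))"
proof (rule bilinear_mapI)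
  fix x assume "x \<in> vcarrier A"
  then show "linear_map B C (\<lambda>y. m (f x) (g y))"
    using linear_map_comp[OF g bilinear_map_right[OF m]] linear_map_in[OF f] by blast
next
  fix y assume "y \<in> vcarrier B"
  then show "linear_map A C (\<lambda>x. m (f x) (g y))"
    using linear_map_comp[OF f bilinear_map_left[OF m]] linear_map_in[OF g] by blast
qed

lemma bilinear_map_comp_result:
  assumes "bilinear_map A B C m" "linear_map C D f"
  shows "bilinear_map A B D (\<lambda>x y. f (m x y))"
  using assms by (auto intro!: bilinear_mapI intro: linear_map_comp
      dest: bilinear_map_right bilinear_map_left)

lemma linear_map_diff_map:
  assumes "is_vspace B" "linear_map A B f" "linear_map A B g"
  shows "linear_map A B (\<lambda>x. f x - g x)"
  using assms
  by (auto intro!: linear_mapI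
      simp: linear_map_add linear_map_scale linear_map_in is_vspace_diff vscale_distrib)

lemma bilinear_map_diff_map:
  assumes "is_vspace C" "bilinear_map A B C f" "bilinear_map A B C g"
  shows "bilinear_map A B C (\<lambda>x y. f x y - g x y)"
  using assms by (auto simp: bilinear_map_def intro: linear_map_diff_map)

lemma is_vspace_kernel_space:
  assumes A: "is_vspace A" and h: "linear_map A B h" and B: "is_vspace B"
  shows "is_vspace (kernel_space A h)"
proof -
  interpret vector_space "vscale A" using A by (rule is_vspace_vector_space)
  have "subspace {x \<in> vcarrier A. h x = 0}"
    using A h B
    by (auto simp: subspace_def is_vspace_closed linear_map_zero[OF A h] linear_map_add
        linear_map_scale vscale_distrib)
  then show ?thesis
    by (simp add: is_vspace_def kernel_space_def vector_space_axioms)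
qed

lemma is_vspace_crossed_product:
  assumes A: "is_vspace A" and B: "is_vspace B"
  shows "is_vspace (crossed_product A B \<Omega>)"
proof -
  interpret A: vector_space "vscale A" using A by (rule is_vspace_vector_space)
  interpret B: vector_space "vscale B" using B by (rule is_vspace_vector_space)
  interpret AB: vector_space "\<lambda>c. map_prod (vscale A c) (vscale B c)"
    by unfold_locales
      (auto simp: A.scale_right_distrib A.scale_left_distrib B.scale_right_distrib
        B.scale_left_distrib)
  have "AB.subspace (vcarrier A \<times> vcarrier B)"
    unfolding AB.subspace_def using A B by (auto simp: is_vspace_closed zero_prod_def)
  then show ?thesis
    by (simp add: is_vspace_def crossed_product_def AB.vector_space_axioms)
qed

text \<open>
  Lift a basis of the carrier of \<open>P\<close> to the carrier of \<open>E\<close> and extend linearly. Since \<open>h\<close> is linear only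
  on the carrier of \<open>E\<close>, it need not be a linear map of the ambient types; so the induction over the span of
  the basis proves \<open>h (s p) = p\<close> together with \<open>s p\<close> being in that carrier.
\<close>

lemma linear_section_exists:
  assumes E: "is_vspace E" and P: "is_vspace P"
    and h: "linear_map E P h" and surj: "h ` vcarrier E = vcarrier P"
  shows "\<exists>s. linear_map P E s \<and> (\<forall>p\<in>vcarrier P. h (s p) = p)"
proof -
  interpret vector_space_pair "vscale P" "vscale E"
    using E P by (simp add: vector_space_pair_def is_vspace_vector_space)
  have subP: "vs1.subspace (vcarrier P)" using P by (simp add: is_vspace_def)
  obtain B where B: "B \<subseteq> vcarrier P" "vs1.independent B" "vcarrier P \<subseteq> vs1.span B"
    using vs1.basis_exists[of "vcarrier P"] by metis
  have spanB: "vs1.span B = vcarrier P"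
    using B subP by (meson subset_antisym vs1.span_minimal)
  define lift where "lift b = inv_into (vcarrier E) h b" for b
  have lift: "lift b \<in> vcarrier E \<and> h (lift b) = b" if "b \<in> B" for b
    using that B(1) surj by (metis f_inv_into_f inv_into_into lift_def subsetD)
  define s where "s = construct B lift"
  interpret s: Vector_Spaces.linear "vscale P" "vscale E" s
    unfolding s_def by (rule linear_construct[OF B(2)])
  have s: "s p \<in> vcarrier E \<and> h (s p) = p" if "p \<in> vcarrier P" for p
  proof (rule vs1.span_induct[of p B])
    show "p \<in> vs1.span B" using that spanB by simp
    show "vs1.subspace {p. s p \<in> vcarrier E \<and> h (s p) = p}"
      using E h
      by (auto simp: vs1.subspace_def s.zero s.add s.scale is_vspace_closed
          linear_map_zero[OF E h] linear_map_add linear_map_scale)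
    show "s b \<in> vcarrier E \<and> h (s b) = b" if "b \<in> B" for b
      using lift[OF that] construct_basis[OF B(2) that, of lift] by (simp add: s_def)
  qed
  have "linear_map P E s"
    using s by (auto intro!: linear_mapI simp: s.add s.scale)
  then show ?thesis using s by blast
qed


section \<open>Poisson algebras and their transport\<close>

lemma
  assumes "poisson_algebra A"
  shows poisson_algebra_is_vspace: "is_vspace A"
    and poisson_algebra_bilinear_mult: "bilinear_map A A A (pmult A)"
    and poisson_algebra_bilinear_bracket: "bilinear_map A A A (pbracket A)"
    and poisson_algebra_assoc: "x \<in> vcarrier A \<Longrightarrow> y \<in> vcarrier A \<Longrightarrow> z \<in> vcarrier A \<Longrightarrow>
      pmult A (pmult A x y) z = pmult A x (pmult A y z)"
    and poisson_algebra_alternating: "x \<in> vcarrier A \<Longrightarrow> pbracket A x x = 0"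
    and poisson_algebra_jacobi: "x \<in> vcarrier A \<Longrightarrow> y \<in> vcarrier A \<Longrightarrow> z \<in> vcarrier A \<Longrightarrow>
      pbracket A x (pbracket A y z) + pbracket A y (pbracket A z x)
        + pbracket A z (pbracket A x y) = 0"
    and poisson_algebra_leibniz: "x \<in> vcarrier A \<Longrightarrow> y \<in> vcarrier A \<Longrightarrow> z \<in> vcarrier A \<Longrightarrow>
      pbracket A (pmult A x y) z = pmult A (pbracket A x z) y + pmult A x (pbracket A y z)"
  using assms by (simp_all add: poisson_algebra_def assoc_mult_def lie_bracket_def)

lemma
  assumes "poisson_algebra A" "x \<in> vcarrier A" "y \<in> vcarrier A"
  shows poisson_algebra_mult_in: "pmult A x y \<in> vcarrier A"
    and poisson_algebra_bracket_in: "pbracket A x y \<in> vcarrier A"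
  using assms by (blast intro: bilinear_map_in poisson_algebra_bilinear_mult
      poisson_algebra_bilinear_bracket)+

lemma poisson_algebra_antisym:
  assumes A: "poisson_algebra A" and x: "x \<in> vcarrier A" and y: "y \<in> vcarrier A"
  shows "pbracket A x y = - pbracket A y x"
proof -
  note V = poisson_algebra_is_vspace[OF A] and b = poisson_algebra_bilinear_bracket[OF A]
  have "0 = pbracket A (x + y) (x + y)"
    using poisson_algebra_alternating[OF A is_vspace_add[OF V x y]] by simp
  also have "\<dots> = pbracket A x y + pbracket A y x"
    using x y by (simp add: bilinear_map_add_left[OF b] bilinear_map_add_right[OF b]
        is_vspace_add[OF V] poisson_algebra_alternating[OF A x] poisson_algebra_alternating[OF A y])
  finally show ?thesis by (simp add: eq_neg_iff_add_eq_0)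
qed

text \<open>
  An injective linear map reflects equations, so it is enough to check every axiom, bilinearity of the
  operations included, on images, where it is an axiom of the target.
\<close>

lemma poisson_algebra_reflect:
  assumes A: "is_vspace A" and B: "poisson_algebra B"
    and h: "poisson_hom A B h" and inj: "inj_on h (vcarrier A)"
    and mult_in: "\<And>x y. x \<in> vcarrier A \<Longrightarrow> y \<in> vcarrier A \<Longrightarrow> pmult A x y \<in> vcarrier A"
    and bracket_in: "\<And>x y. x \<in> vcarrier A \<Longrightarrow> y \<in> vcarrier A \<Longrightarrow> pbracket A x y \<in> vcarrier A"
  shows "poisson_algebra A"
proof -
  have lin: "linear_map A B h" using h by (simp add: poisson_hom_def)
  note closed = is_vspace_closed[OF A] mult_in bracket_in
  note hin = linear_map_in[OF lin]
  have hm: "h (pmult A x y) = pmult B (h x) (h y)"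
    and hb: "h (pbracket A x y) = pbracket B (h x) (h y)"
    if "x \<in> vcarrier A" "y \<in> vcarrier A" for x y
    using h that by (simp_all add: poisson_hom_def)
  note hsimps = hm hb linear_map_add[OF lin] linear_map_scale[OF lin] linear_map_zero[OF A lin]
  have reflect: "x = y" if "h x = h y" "x \<in> vcarrier A" "y \<in> vcarrier A" for x y
    using inj that by (simp add: inj_onD)
  have bilinear: "bilinear_map A A A op"
    if op': "bilinear_map B B B op'"
      and op: "\<And>x y. x \<in> vcarrier A \<Longrightarrow> y \<in> vcarrier A \<Longrightarrow> h (op x y) = op' (h x) (h y)"
      and op_in: "\<And>x y. x \<in> vcarrier A \<Longrightarrow> y \<in> vcarrier A \<Longrightarrow> op x y \<in> vcarrier A"
    for op op'
    by (intro bilinear_mapI linear_mapI op_in reflect)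
      (simp_all add: op op_in closed hin hsimps linear_map_scale[OF bilinear_map_right[OF op']]
        linear_map_scale[OF bilinear_map_left[OF op']]
        bilinear_map_add_left[OF op'] bilinear_map_add_right[OF op'])
  have "assoc_mult A (pmult A)"
    unfolding assoc_mult_def
    by (intro conjI ballI bilinear[OF poisson_algebra_bilinear_mult[OF B]] reflect)
      (simp_all add: closed hsimps hin poisson_algebra_assoc[OF B])
  moreover have "lie_bracket A (pbracket A)"
    unfolding lie_bracket_def
    by (intro conjI ballI bilinear[OF poisson_algebra_bilinear_bracket[OF B]] reflect)
      (simp_all add: closed hsimps hin poisson_algebra_alternating[OF B] poisson_algebra_jacobi[OF B])
  moreover have "pbracket A (pmult A x y) z = pmult A (pbracket A x z) y + pmult A x (pbracket A y z)"
    if "x \<in> vcarrier A" "y \<in> vcarrier A" "z \<in> vcarrier A" for x y z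
    using that by (intro reflect) (simp_all add: closed hsimps hin poisson_algebra_leibniz[OF B])
  ultimately show ?thesis using A by (simp add: poisson_algebra_def)
qed

lemma poisson_iso_inv_into:
  assumes A: "poisson_algebra A" and iso: "poisson_iso A B h"
  shows "poisson_iso B A (inv_into (vcarrier A) h)" (is "poisson_iso B A ?g")
proof -
  have h: "linear_map A B h" and bij: "bij_betw h (vcarrier A) (vcarrier B)"
    and hm: "\<And>x y. x \<in> vcarrier A \<Longrightarrow> y \<in> vcarrier A \<Longrightarrow> h (pmult A x y) = pmult B (h x) (h y)"
    and hb: "\<And>x y. x \<in> vcarrier A \<Longrightarrow> y \<in> vcarrier A \<Longrightarrow>
      h (pbracket A x y) = pbracket B (h x) (h y)"
    using iso by (simp_all add: poisson_iso_def poisson_hom_def)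
  have g: "bij_betw ?g (vcarrier B) (vcarrier A)" using bij by (rule bij_betw_inv_into)
  have gin: "?g u \<in> vcarrier A" and hg: "h (?g u) = u" if "u \<in> vcarrier B" for u
    using that g bij by (auto dest: bij_betwE bij_betw_inv_into_right)
  have gI: "?g u = x" if "x \<in> vcarrier A" "h x = u" for u x
    using that bij by (auto simp: bij_betw_inv_into_left)
  note closed = is_vspace_closed[OF poisson_algebra_is_vspace[OF A]]
    poisson_algebra_mult_in[OF A] poisson_algebra_bracket_in[OF A]
  have "poisson_hom B A ?g"
    unfolding poisson_hom_def
    by (intro conjI ballI linear_mapI gI)
      (simp_all add: gin hg closed hm hb linear_map_add[OF h] linear_map_scale[OF h])
  then show ?thesis using g by (simp add: poisson_iso_def)
qed


section \<open>The crossed product of a linearly split extension\<close>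

text \<open>
  The operations on \<open>V\<close> are induced by those of \<open>E\<close>, because the kernel of \<open>\<pi>\<close> is an ideal; so \<open>V\<close>
  enters as a bare vector space. In the datum below, \<open>\<vartheta>\<close> and \<open>f\<close> measure the defect of \<open>s\<close> from
  being a morphism, and the other five maps are products and brackets in \<open>E\<close> with a factor in the
  kernel; all are read back in \<open>V\<close> along \<open>i\<close>.
\<close>

locale linearly_split_extension =
  fixes P :: "('k::field, 'p::ab_group_add) poisson"
    and V :: "('k, 'v::ab_group_add, 'n) vspace_scheme"
    and E :: "('k, 'e::ab_group_add) poisson"
    and i :: "'v \<Rightarrow> 'e" and \<pi> :: "'e \<Rightarrow> 'p" and s :: "'p \<Rightarrow> 'e"
  assumes P: "poisson_algebra P" and V: "is_vspace V" and E: "poisson_algebra E"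
    and i: "linear_map V E i" and inj_i: "inj_on i (vcarrier V)"
    and image_i: "i ` vcarrier V = {e \<in> vcarrier E. \<pi> e = 0}"
    and hom_pi: "poisson_hom E P \<pi>"
    and s: "linear_map P E s" and pi_s: "p \<in> vcarrier P \<Longrightarrow> \<pi> (s p) = p"
begin

definition coord :: "'e \<Rightarrow> 'v" where
  "coord = inv_into (vcarrier V) i"

definition datum :: "('p, 'v) datum" where
  "datum = \<lparr>
     d_lact = (\<lambda>p x. coord (pmult E (s p) (i x))),
     d_ract = (\<lambda>x p. coord (pmult E (i x) (s p))),
     d_theta = (\<lambda>p q. coord (pmult E (s p) (s q) - s (pmult P p q))),
     d_mult = (\<lambda>x y. coord (pmult E (i x) (i y))),
     d_lieact = (\<lambda>p x. coord (pbracket E (s p) (i x))),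
     d_f = (\<lambda>p q. coord (pbracket E (s p) (s q) - s (pbracket P p q))),
     d_bracket = (\<lambda>x y. coord (pbracket E (i x) (i y)))\<rparr>"

definition glue :: "'p \<times> 'v \<Rightarrow> 'e" where
  "glue = (\<lambda>(p, x). s p + i x)"

lemma Pv: "is_vspace P" and Ev: "is_vspace E"
  using P E by (simp_all add: poisson_algebra_is_vspace)

lemmas mP = poisson_algebra_bilinear_mult[OF P] and bP = poisson_algebra_bilinear_bracket[OF P]
  and mE = poisson_algebra_bilinear_mult[OF E] and bE = poisson_algebra_bilinear_bracket[OF E]

lemma pi: "linear_map E P \<pi>"
  and pi_mult: "e \<in> vcarrier E \<Longrightarrow> e' \<in> vcarrier E \<Longrightarrow> \<pi> (pmult E e e') = pmult P (\<pi> e) (\<pi> e')"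
  and pi_bracket: "e \<in> vcarrier E \<Longrightarrow> e' \<in> vcarrier E \<Longrightarrow>
    \<pi> (pbracket E e e') = pbracket P (\<pi> e) (\<pi> e')"
  using hom_pi by (simp_all add: poisson_hom_def)

lemmas pi_simps = pi_s pi_mult pi_bracket linear_map_add[OF pi] linear_map_diff[OF Ev pi]

lemmas in_carrier = is_vspace_closed[OF Pv] is_vspace_closed[OF Ev] is_vspace_closed[OF V]
  linear_map_in[OF s] linear_map_in[OF i] linear_map_in[OF pi]
  bilinear_map_in[OF mP] bilinear_map_in[OF bP] bilinear_map_in[OF mE] bilinear_map_in[OF bE]

lemmas zero_simps =
  bilinear_map_zero_left[OF mP Pv] bilinear_map_zero_right[OF mP Pv]
  bilinear_map_zero_left[OF bP Pv] bilinear_map_zero_right[OF bP Pv]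
  linear_map_zero[OF Pv s] linear_map_zero[OF V i]

lemma pi_i: "x \<in> vcarrier V \<Longrightarrow> \<pi> (i x) = 0"
  using image_i by blast

lemma coord_in: "e \<in> vcarrier E \<Longrightarrow> \<pi> e = 0 \<Longrightarrow> coord e \<in> vcarrier V"
  and i_coord: "e \<in> vcarrier E \<Longrightarrow> \<pi> e = 0 \<Longrightarrow> i (coord e) = e"
  using image_i unfolding coord_def by (auto intro: inv_into_into f_inv_into_f)

lemma coord_eqI: "x \<in> vcarrier V \<Longrightarrow> i x = e \<Longrightarrow> coord e = x"
  using inj_i by (auto simp: coord_def)

lemma linear_coord: "linear_map (kernel_space E \<pi>) V coord"
  by (rule linear_mapI)
    (auto simp: kernel_space_def coord_in i_coord in_carrier linear_map_add[OF i]
      linear_map_scale[OF i] intro!: coord_eqI)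

lemma bilinear_coord:
  assumes h: "bilinear_map A B E h"
    and ker: "\<And>x y. x \<in> vcarrier A \<Longrightarrow> y \<in> vcarrier B \<Longrightarrow> \<pi> (h x y) = 0"
  shows "bilinear_map A B V (\<lambda>x y. coord (h x y))"
proof (rule bilinear_map_comp_result[OF _ linear_coord])
  show "bilinear_map A B (kernel_space E \<pi>) h"
    using h ker by (auto simp: bilinear_map_def linear_map_def kernel_space_def)
qed

lemma pre_crossed_datum_datum: "pre_crossed_datum P V datum"
  unfolding pre_crossed_datum_def datum_def datum.simps
  by (intro conjI bilinear_coord bilinear_map_diff_map[OF Ev] bilinear_map_comp_args[OF mE]
      bilinear_map_comp_args[OF bE] bilinear_map_comp_result[OF mP s]
      bilinear_map_comp_result[OF bP s] s i)
    (simp_all add: pi_simps pi_i zero_simps in_carrier)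

lemma datum_in:
  assumes "p \<in> vcarrier P" "q \<in> vcarrier P" "x \<in> vcarrier V" "y \<in> vcarrier V"
  shows "d_theta datum p q + d_lact datum p y + d_ract datum x q + d_mult datum x y \<in> vcarrier V"
    and "d_f datum p q + d_lieact datum p y - d_lieact datum q x + d_bracket datum x y \<in> vcarrier V"
  using pre_crossed_datum_datum assms unfolding pre_crossed_datum_def
  by (auto intro!: is_vspace_add[OF V] is_vspace_diff[OF V] intro: bilinear_map_in)

lemma i_datum:
  assumes "p \<in> vcarrier P" "q \<in> vcarrier P" "x \<in> vcarrier V" "y \<in> vcarrier V"
  shows "i (d_theta datum p q + d_lact datum p y + d_ract datum x q + d_mult datum x y) =
      pmult E (s p) (s q) - s (pmult P p q) + pmult E (s p) (i y) + pmult E (i x) (s q)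
        + pmult E (i x) (i y)"
    and "i (d_f datum p q + d_lieact datum p y - d_lieact datum q x + d_bracket datum x y) =
      pbracket E (s p) (s q) - s (pbracket P p q) + pbracket E (s p) (i y) - pbracket E (s q) (i x)
        + pbracket E (i x) (i y)"
  using assms
  by (simp_all add: datum_def linear_map_add[OF i] linear_map_diff[OF V i] i_coord coord_in
      pi_simps pi_i zero_simps in_carrier)

lemma pi_glue:
  assumes "p \<in> vcarrier P" "x \<in> vcarrier V"
  shows "\<pi> (glue (p, x)) = p"
  using assms by (simp add: glue_def pi_simps pi_i in_carrier)

lemma bij_glue: "bij_betw glue (vcarrier P \<times> vcarrier V) (vcarrier E)"
proof (rule bij_betw_byWitness[where f' = "\<lambda>e. (\<pi> e, coord (e - s (\<pi> e)))"])
  show "\<forall>a\<in>vcarrier P \<times> vcarrier V. (\<pi> (glue a), coord (glue a - s (\<pi> (glue a)))) = a"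
    by (auto simp: pi_glue intro!: coord_eqI) (simp add: glue_def)
  show "\<forall>e\<in>vcarrier E. glue (\<pi> e, coord (e - s (\<pi> e))) = e"
    by (simp add: glue_def i_coord in_carrier pi_simps)
qed (auto simp: glue_def coord_in in_carrier pi_simps)

text \<open>
  The product and bracket of two sums \<open>s p + i x\<close> are expanded by bilinearity. In the bracket the mixed
  term \<open>[i x, s q]\<close> is turned around by antisymmetry, which is where the minus sign in the bracket of
  \<open>P \<sharp> V\<close> comes from.
\<close>

lemma poisson_hom_glue: "poisson_hom (crossed_product P V datum) E glue"
proof -
  have lin: "linear_map (crossed_product P V datum) E glue"
    by (rule linear_mapI)
      (auto simp: crossed_product_def glue_def in_carrier linear_map_add[OF s] linear_map_add[OF i]
        linear_map_scale[OF s] linear_map_scale[OF i] vscale_distrib[OF Ev])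
  have ops: "glue (pmult (crossed_product P V datum) (p, x) (q, y)) =
        pmult E (glue (p, x)) (glue (q, y))"
    "glue (pbracket (crossed_product P V datum) (p, x) (q, y)) =
        pbracket E (glue (p, x)) (glue (q, y))"
    if "p \<in> vcarrier P" "q \<in> vcarrier P" "x \<in> vcarrier V" "y \<in> vcarrier V" for p q x y
    using that poisson_algebra_antisym[OF E, of "i x" "s q"]
    by (simp_all add: crossed_product_def glue_def i_datum in_carrier
        bilinear_map_add_left[OF mE] bilinear_map_add_right[OF mE]
        bilinear_map_add_left[OF bE] bilinear_map_add_right[OF bE])
  have "vcarrier (crossed_product P V datum) = vcarrier P \<times> vcarrier V"
    by (simp add: crossed_product_def)
  then show ?thesis unfolding poisson_hom_def using lin ops by auto
qed

lemma poisson_iso_glue: "poisson_iso (crossed_product P V datum) E glue"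
  unfolding poisson_iso_def using poisson_hom_glue bij_glue by (simp add: crossed_product_def)

lemma crossed_system_datum: "crossed_system P V datum"
proof -
  have "poisson_algebra (crossed_product P V datum)"
  proof (rule poisson_algebra_reflect[OF is_vspace_crossed_product[OF Pv V] E poisson_hom_glue])
    show "inj_on glue (vcarrier (crossed_product P V datum))"
      using bij_glue by (simp add: crossed_product_def bij_betw_def)
  qed (auto simp: crossed_product_def datum_in in_carrier)
  then show ?thesis using pre_crossed_datum_datum by (simp add: crossed_system_def)
qed

lemma glue_zero_left: "glue (0, x) = i x"
  by (simp add: glue_def zero_simps)

end


text \<open>
  All maps of the datum except \<open>\<cdot>\<^sub>V\<close> and \<open>[-,-]\<^sub>V\<close> are bilinear with an argument in \<open>P\<close>, so only these
  two survive in the product and bracket of \<open>(0, x)\<close> and \<open>(0, y)\<close>. The inclusion of \<open>V\<close> is therefore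
  a morphism as soon as they are the operations of \<open>V\<close>.
\<close>

lemma poisson_extension_crossed_product:
  assumes P: "poisson_algebra P" and V: "poisson_algebra V" and \<Omega>: "crossed_system P V \<Omega>"
    and mult: "\<And>x y. x \<in> vcarrier V \<Longrightarrow> y \<in> vcarrier V \<Longrightarrow> d_mult \<Omega> x y = pmult V x y"
    and bracket: "\<And>x y. x \<in> vcarrier V \<Longrightarrow> y \<in> vcarrier V \<Longrightarrow> d_bracket \<Omega> x y = pbracket V x y"
  shows "poisson_extension V (\<lambda>x. (0, x)) (crossed_product P V \<Omega>) fst P"
proof -
  note Pv = poisson_algebra_is_vspace[OF P] and Vv = poisson_algebra_is_vspace[OF V]
  note mP = poisson_algebra_bilinear_mult[OF P] and bP = poisson_algebra_bilinear_bracket[OF P]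
  have dat: "bilinear_map P V V (d_lact \<Omega>)" "bilinear_map V P V (d_ract \<Omega>)"
    "bilinear_map P P V (d_theta \<Omega>)" "bilinear_map P V V (d_lieact \<Omega>)" "bilinear_map P P V (d_f \<Omega>)"
    and PV: "poisson_algebra (crossed_product P V \<Omega>)"
    using \<Omega> by (simp_all add: crossed_system_def pre_crossed_datum_def)
  note zeros = is_vspace_zero[OF Pv] is_vspace_zero[OF Vv] vscale_distrib[OF Pv]
    bilinear_map_zero_left[OF mP Pv] bilinear_map_zero_left[OF bP Pv]
    bilinear_map_zero_left[OF dat(1) Pv] bilinear_map_zero_right[OF dat(2) Pv]
    bilinear_map_zero_left[OF dat(3) Pv] bilinear_map_zero_left[OF dat(4) Pv]
    bilinear_map_zero_left[OF dat(5) Pv]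
  have "poisson_hom V (crossed_product P V \<Omega>) (\<lambda>x. (0, x))"
    by (auto simp: poisson_hom_def linear_map_def crossed_product_def zeros mult bracket)
  moreover have "poisson_hom (crossed_product P V \<Omega>) P fst"
    by (auto simp: poisson_hom_def linear_map_def crossed_product_def)
  moreover have "inj_on (\<lambda>x. (0 :: 'b, x)) (vcarrier V)" by (simp add: inj_on_def)
  moreover have "(\<lambda>x. (0, x)) ` vcarrier V = {e \<in> vcarrier (crossed_product P V \<Omega>). fst e = 0}"
    by (auto simp: crossed_product_def zeros)
  moreover have "fst ` vcarrier (crossed_product P V \<Omega>) = vcarrier P"
    using zeros(2) by (force simp: crossed_product_def)
  ultimately show ?thesis using P V PV by (simp add: poisson_extension_def)
qed

theorem proposition2p4:
  fixes P :: "('k::field, 'p::ab_group_add) poisson"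
  assumes "poisson_algebra P"
  shows
    "(\<forall>(E :: ('k, 'e::ab_group_add) vspace) (\<pi> :: 'e \<Rightarrow> 'p).
        is_vspace E \<and> linear_map E P \<pi> \<and> \<pi> ` vcarrier E = vcarrier P \<longrightarrow>
        (\<forall>m b. poisson_algebra (equip E m b) \<and> poisson_hom (equip E m b) P \<pi> \<longrightarrow>
           (\<exists>\<Omega> \<phi>. crossed_system P (kernel_space E \<pi>) \<Omega> \<and>
              poisson_iso (crossed_product P (kernel_space E \<pi>) \<Omega>) (equip E m b) \<phi> \<and>
              stabilizes (kernel_space E \<pi>) \<phi> \<and>
              costabilizes P (kernel_space E \<pi>) \<pi> \<phi>)))
     \<and>
     (\<forall>(V :: ('k, 'v::ab_group_add) poisson) (E :: ('k, 'd::ab_group_add) poisson) i p.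
        poisson_extension V i E p P \<longrightarrow>
        (\<exists>\<Omega>. crossed_system P V \<Omega> \<and>
           poisson_extension V (\<lambda>x. (0, x)) (crossed_product P V \<Omega>) fst P \<and>
           cohomologous V i E p (\<lambda>x. (0, x)) (crossed_product P V \<Omega>) fst))"
proof (intro conjI allI impI)
  fix E :: "('k, 'e) vspace" and \<pi> :: "'e \<Rightarrow> 'p" and m b
  assume "is_vspace E \<and> linear_map E P \<pi> \<and> \<pi> ` vcarrier E = vcarrier P"
  then have E: "is_vspace E" and \<pi>: "linear_map E P \<pi>" and surj: "\<pi> ` vcarrier E = vcarrier P"
    by auto
  assume "poisson_algebra (equip E m b) \<and> poisson_hom (equip E m b) P \<pi>"
  then have Emb: "poisson_algebra (equip E m b)" and hom: "poisson_hom (equip E m b) P \<pi>" by auto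
  have P: "is_vspace P" using assms by (rule poisson_algebra_is_vspace)
  obtain s where s: "linear_map P E s" "\<And>p. p \<in> vcarrier P \<Longrightarrow> \<pi> (s p) = p"
    using linear_section_exists[OF E P \<pi> surj] by blast
  interpret split: linearly_split_extension P "kernel_space E \<pi>" "equip E m b" "\<lambda>x. x" \<pi> s
    using assms Emb hom s is_vspace_kernel_space[OF E \<pi> P]
    by unfold_locales (auto simp: linear_map_def kernel_space_def equip_def)
  show "\<exists>\<Omega> \<phi>. crossed_system P (kernel_space E \<pi>) \<Omega> \<and>
      poisson_iso (crossed_product P (kernel_space E \<pi>) \<Omega>) (equip E m b) \<phi> \<and>
      stabilizes (kernel_space E \<pi>) \<phi> \<and> costabilizes P (kernel_space E \<pi>) \<pi> \<phi>"
    using split.crossed_system_datum split.poisson_iso_glue split.glue_zero_left split.pi_glue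
    unfolding stabilizes_def costabilizes_def by blast
next
  fix V :: "('k, 'v) poisson" and E :: "('k, 'd) poisson" and i :: "'v \<Rightarrow> 'd" and p :: "'d \<Rightarrow> 'p"
  assume "poisson_extension V i E p P"
  then have V: "poisson_algebra V" and E: "poisson_algebra E"
    and i: "poisson_hom V E i" and p: "poisson_hom E P p" and inj: "inj_on i (vcarrier V)"
    and exact: "i ` vcarrier V = {e \<in> vcarrier E. p e = 0}" and surj: "p ` vcarrier E = vcarrier P"
    by (simp_all add: poisson_extension_def)
  have "linear_map E P p" using p by (simp add: poisson_hom_def)
  then obtain s where s: "linear_map P E s" "\<And>x. x \<in> vcarrier P \<Longrightarrow> p (s x) = x"
    using linear_section_exists[OF poisson_algebra_is_vspace[OF E]
        poisson_algebra_is_vspace[OF assms] _ surj] by blast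
  interpret split: linearly_split_extension P V E i p s
    using assms V E i p inj exact s poisson_algebra_is_vspace[OF V]
    by unfold_locales (auto simp: poisson_hom_def)
  \<comment> \<open>The operations which \<open>E\<close> induces on \<open>V\<close> are the given ones, because \<open>i\<close> is a morphism.\<close>
  have ops: "d_mult split.datum x y = pmult V x y" "d_bracket split.datum x y = pbracket V x y"
    if "x \<in> vcarrier V" "y \<in> vcarrier V" for x y
    using that i V
    by (auto simp: split.datum_def poisson_hom_def poisson_algebra_mult_in poisson_algebra_bracket_in
        intro!: split.coord_eqI)
  let ?PV = "crossed_product P V split.datum"
  have ext: "poisson_extension V (\<lambda>x. (0, x)) ?PV fst P"
    using poisson_extension_crossed_product[OF assms V split.crossed_system_datum] ops by blast
  have carrier: "vcarrier ?PV = vcarrier P \<times> vcarrier V" by (simp add: crossed_product_def)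
  let ?split = "inv_into (vcarrier ?PV) split.glue"
  have "poisson_iso E ?PV ?split"
    using split.crossed_system_datum split.poisson_iso_glue
    by (intro poisson_iso_inv_into) (simp_all add: crossed_system_def)
  moreover have "?split (i x) = (0, x)" if "x \<in> vcarrier V" for x
    using that bij_betw_inv_into_left[OF split.bij_glue, of "(0, x)"]
    by (simp add: carrier split.glue_zero_left split.in_carrier)
  moreover have "fst (?split e) = p e" if "e \<in> vcarrier E" for e
  proof -
    have "?split e \<in> vcarrier P \<times> vcarrier V" and "split.glue (?split e) = e"
      using that split.bij_glue unfolding carrier
      by (auto dest: bij_betw_inv_into_right bij_betwE[OF bij_betw_inv_into])
    then show ?thesis using split.pi_glue[of "fst (?split e)" "snd (?split e)"]
      by (simp add: mem_Times_iff)
  qed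
  ultimately have "cohomologous V i E p (\<lambda>x. (0, x)) ?PV fst"
    unfolding cohomologous_def by blast
  then show "\<exists>\<Omega>. crossed_system P V \<Omega> \<and>
      poisson_extension V (\<lambda>x. (0, x)) (crossed_product P V \<Omega>) fst P \<and>
      cohomologous V i E p (\<lambda>x. (0, x)) (crossed_product P V \<Omega>) fst"
    using split.crossed_system_datum ext by blast
qed

end
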